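(* Let $m\ge1$ be an integer, $n=4m$, and let $M_n$ be the $n\times n$ doubly even magic square generated by MATLAB's criss-cross method. Then the rank of $M_n$ is $3$, and the non-zero non-trivial eigenvalues of $M_n$ are $$\pm\frac n2\sqrt{\frac{n^3-n}{3}}.$$ The corresponding eigenvectors are $\sqrt{n^2-1}\,v\pm\sqrt{3n}\,u$ (signs taken correspondingly), where $$u=\begin{bmatrix}w\\-\mathrm{flip}(w)\end{bmatrix}\in\mathbb R^{4m},\qquad v^T=\begin{bmatrix}1&-1&-1&1&\cdots&1&-1&-1&1\end{bmatrix}\in\mathbb R^{1\times 4m},$$ with $w\in\mathbb R^{2m}$ given by $$w^T=\begin{bmatrix}(n-1)&-(n-3)&-(n-5)&(n-7)&\cdots&(-1)^m\end{bmatrix}.$$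
   Context: For $n=4m$, the doubly even magic square $M_n$ generated by the criss-cross method (as implemented in MATLAB's magic(n)) is defined as follows. For $i,j\in\{1,\ldots,n\}$ put $S(i,j)=j+(i-1)n$, and let $f(i)=\left\lfloor (i\bmod 4)/2\right\rfloor$, where $i\bmod4\in\{0,1,2,3\}$. Then $$M_n(i,j)=\begin{cases} n^2+1-S(i,j) & \text{if } f(i)=f(j),\\ S(i,j)&\text{otherwise.}\end{cases}$$ The vector $v$ is the pattern $(1,-1,-1,1)$ repeated $m$ times. The vector $w$ has entries $w_i=v_i\,(n+1-2i)$ for $1\le i\le 2m$, and $\mathrm{flip}(w)$ is $w$ with the order of its entries reversed. The all-ones vector is an eigenvector of $M_n$ with eigenvalue the magic sum $\mu_0=\frac{n(n^2+1)}2$; this is called the trivial eigenpair, and $\mu_0$ has multiplicity one. Non-trivial eigenvalues are the other $n-1$ eigenvalues, counted with multiplicity. *)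

theory Defs
  imports Complex_Main "HOL-Library.Multiset" "HOL-Computational_Algebra.Polynomial"
    "Jordan_Normal_Form.Char_Poly" "Jordan_Normal_Form.DL_Rank"
begin

text \<open>The functions \<open>square_S\<close>, \<open>criss_cross\<close>, \<open>magic_entry\<close> and \<open>v_entry\<close> take indices
  starting at 1, as in the mathematical definition; matrices and vectors are indexed from 0.\<close>

definition square_S :: "nat \<Rightarrow> nat \<Rightarrow> nat \<Rightarrow> nat" where
  "square_S n i j = j + (i - 1) * n"

definition criss_cross :: "nat \<Rightarrow> nat" where
  "criss_cross i = (i mod 4) div 2"

definition magic_entry :: "nat \<Rightarrow> nat \<Rightarrow> nat \<Rightarrow> real" where
  "magic_entry n i j =
     (if criss_cross i = criss_cross j then (real n)\<^sup>2 + 1 - real (square_S n i j)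
      else real (square_S n i j))"

text \<open>This is the doubly even magic square only if \<open>n\<close> is a multiple of 4.\<close>

definition magic_mat :: "nat \<Rightarrow> real mat" where
  "magic_mat n = mat n n (\<lambda>(i, j). magic_entry n (i + 1) (j + 1))"

definition magic_sum :: "nat \<Rightarrow> real" where
  "magic_sum n = real n * ((real n)\<^sup>2 + 1) / 2"

text \<open>All complex eigenvalues, counted with algebraic multiplicity.\<close>

definition eigenvalue_mset :: "real mat \<Rightarrow> complex multiset" where
  "eigenvalue_mset A = proots (char_poly (map_mat complex_of_real A))"

text \<open>One occurrence of the magic sum is removed; by \<open>magic_sum_in_eigenvalue_mset\<close> below this
  leaves \<open>n - 1\<close> eigenvalues.\<close>

definition nontrivial_eigenvalues :: "nat \<Rightarrow> complex multiset" where
  "nontrivial_eigenvalues n =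
     eigenvalue_mset (magic_mat n) - {#complex_of_real (magic_sum n)#}"

definition v_entry :: "nat \<Rightarrow> real" where
  "v_entry i = [1, -1, -1, 1] ! ((i - 1) mod 4)"

definition v_vec :: "nat \<Rightarrow> real vec" where
  "v_vec m = vec (4 * m) (\<lambda>k. v_entry (k + 1))"

definition w_vec :: "nat \<Rightarrow> real vec" where
  "w_vec m = vec (2 * m) (\<lambda>k. v_entry (k + 1) * (real (4 * m) + 1 - 2 * real (k + 1)))"

definition flip_vec :: "real vec \<Rightarrow> real vec" where
  "flip_vec x = vec (dim_vec x) (\<lambda>k. x $ (dim_vec x - 1 - k))"

definition u_vec :: "nat \<Rightarrow> real vec" where
  "u_vec m = w_vec m @\<^sub>v (- flip_vec (w_vec m))"

lemma magic_row_sum: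
  assumes "i \<ge> 1"
  shows "(\<Sum>j<4*k. magic_entry n i (j + 1)) = 2 * real k * ((real n)\<^sup>2 + 1)"
proof (induction k)
  case (Suc k)
  have eq: "4 * Suc k = Suc (Suc (Suc (Suc (4 * k))))" by simp
  have cc: "criss_cross (4*k+1) = 0" "criss_cross (4*k+2) = 1"
    "criss_cross (4*k+3) = 1" "criss_cross (4*k+4) = 0"
    unfolding criss_cross_def by presburger+
  have "criss_cross i = 0 \<or> criss_cross i = 1"
    unfolding criss_cross_def by presburger
  then have "magic_entry n i (4*k+1) + magic_entry n i (4*k+2) +
      magic_entry n i (4*k+3) + magic_entry n i (4*k+4) = 2 * ((real n)\<^sup>2 + 1)"
    unfolding magic_entry_def cc by (auto simp: square_S_def algebra_simps)
  with Suc show ?case unfolding eq sum.lessThan_Suc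
    by (simp add: algebra_simps numeral_eq_Suc)
qed simp

lemma magic_sum_eigenvector:
  assumes "m \<ge> 1"
  shows "eigenvector (magic_mat (4*m)) (vec (4*m) (\<lambda>_. 1)) (magic_sum (4*m))"
proof -
  have "magic_mat (4*m) *\<^sub>v vec (4*m) (\<lambda>_. 1) = magic_sum (4*m) \<cdot>\<^sub>v vec (4*m) (\<lambda>_. 1)"
  proof (rule eq_vecI)
    fix i assume i: "i < dim_vec (magic_sum (4*m) \<cdot>\<^sub>v vec (4*m) (\<lambda>_. 1 :: real))"
    have "(magic_mat (4*m) *\<^sub>v vec (4*m) (\<lambda>_. 1)) $ i
        = (\<Sum>j<4*m. magic_entry (4*m) (i + 1) (j + 1))"
      using i by (simp add: magic_mat_def scalar_prod_def atLeast0LessThan)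
    also have "\<dots> = magic_sum (4*m)"
      by (subst magic_row_sum) (auto simp: magic_sum_def)
    finally show "(magic_mat (4*m) *\<^sub>v vec (4*m) (\<lambda>_. 1)) $ i
        = (magic_sum (4*m) \<cdot>\<^sub>v vec (4*m) (\<lambda>_. 1)) $ i"
      using i by simp
  qed (simp add: magic_mat_def)
  moreover have "vec (4*m) (\<lambda>_. 1 :: real) \<noteq> 0\<^sub>v (4*m)"
  proof
    assume "vec (4*m) (\<lambda>_. 1 :: real) = 0\<^sub>v (4*m)"
    then have "vec (4*m) (\<lambda>_. 1 :: real) $ 0 = 0\<^sub>v (4*m) $ 0" by simp
    with assms show False by simp
  qed
  ultimately show ?thesis
    unfolding eigenvector_def by (simp add: magic_mat_def)
qed

lemma magic_sum_in_eigenvalue_mset: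
  assumes "m \<ge> 1"
  shows "complex_of_real (magic_sum (4*m)) \<in># eigenvalue_mset (magic_mat (4*m))"
proof -
  let ?A = "magic_mat (4*m)"
  have A: "?A \<in> carrier_mat (4*m) (4*m)" by (simp add: magic_mat_def)
  then have A': "map_mat complex_of_real ?A \<in> carrier_mat (4*m) (4*m)" by simp
  have "poly (char_poly ?A) (magic_sum (4*m)) = 0"
    using magic_sum_eigenvector[OF assms] eigenvalue_root_char_poly[OF A]
    unfolding eigenvalue_def by blast
  then have "poly (char_poly (map_mat complex_of_real ?A)) (complex_of_real (magic_sum (4*m))) = 0"
    by (simp add: of_real_hom.char_poly_hom[OF A])
  moreover have "char_poly (map_mat complex_of_real ?A) \<noteq> 0"
    using degree_monic_char_poly[OF A'] by auto
  ultimately show ?thesis unfolding eigenvalue_mset_def by simp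
qed

end

theory Submission
  imports Defs
begin

text \<open>
  The parity test in the criss-cross rule is a product of signs: \<open>v\<^sub>i v\<^sub>j\<close> is \<open>1\<close> when the
  entry is complemented and \<open>- 1\<close> otherwise. Subtracting the mean \<open>(n\<^sup>2 + 1) / 2\<close> from the natural
  filling leaves \<open>- (n c\<^sub>i + c\<^sub>j) / 2\<close> with \<open>c\<^sub>i = n + 1 - 2 i\<close>, and complementing an entry
  changes the sign of this difference. As \<open>u\<^sub>i = v\<^sub>i c\<^sub>i\<close>, the magic square is
  \[ M = \tfrac{n^2+1}{2}\, e e^T + \tfrac{n}{2}\, u v^T + \tfrac12\, v u^T , \]
  where \<open>e\<close> is the all-ones vector (\<open>magic_mat_factorization\<close>). The three vectors are
  orthogonal, with squared lengths \<open>n\<close> for \<open>e\<close> and \<open>v\<close> and \<open>n (n\<^sup>2 - 1) / 3\<close> for \<open>u\<close>.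
  Hence \<open>M v = (n\<^sup>2 / 2) u\<close> and \<open>M u = (n (n\<^sup>2 - 1) / 6) v\<close>, which gives the two
  eigenvectors.

  For the rank and for the algebraic multiplicities, write \<open>M = B C\<close> with \<open>B\<close> having the columns
  \<open>e, u, v\<close>. The product \<open>C B\<close> in the other order is a \<open>3 \<times> 3\<close> matrix, and two general facts
  transfer its properties to \<open>M\<close>: the characteristic polynomials of \<open>B C\<close> and \<open>C B\<close> differ only
  by a power of the variable (\<open>char_poly_mult_swap\<close>), so the two products have the same nonzero
  eigenvalues with the same multiplicities; and if \<open>C B\<close> is invertible, then \<open>B C\<close> has full
  rank for its inner dimension (\<open>rank_mult_if_det_swap_nonzero\<close>). By orthogonality \<open>C B\<close> is block
  diagonal: one block is the magic sum, the other is antidiagonal with entries \<open>n\<^sup>2 / 2\<close> and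
  \<open>n (n\<^sup>2 - 1) / 6\<close>, so its eigenvalues are the two square roots of their product.
\<close>

section \<open>The two products of a pair of rectangular matrices\<close>

lemma char_poly_four_block_upper_right_zero:
  fixes A D :: "'a :: idom mat"
  assumes A: "A \<in> carrier_mat n n" and C: "C \<in> carrier_mat k n" and D: "D \<in> carrier_mat k k"
  shows "char_poly (four_block_mat A (0\<^sub>m n k) C D) = char_poly A * char_poly D"
proof -
  let ?cm = "\<lambda>A. [:0, 1:] \<cdot>\<^sub>m 1\<^sub>m (dim_row A) + map_mat (\<lambda>a. [:- a:]) A"
  have "char_poly (four_block_mat A (0\<^sub>m n k) C D)
      = det (?cm (four_block_mat A (0\<^sub>m n k) C D))"
    unfolding char_poly_defs using A D by simp
  also have "?cm (four_block_mat A (0\<^sub>m n k) C D)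
      = four_block_mat (?cm A) (0\<^sub>m n k) (map_mat (\<lambda>a. [:- a:]) C) (?cm D)"
    by (rule eq_matI) (use A C D in \<open>auto simp: one_poly_def\<close>)
  also have "det \<dots> = det (?cm A) * det (?cm D)"
    by (rule det_four_block_mat_upper_right_zero[OF _ refl]) (use A C D in auto)
  also have "\<dots> = char_poly A * char_poly D" unfolding char_poly_defs ..
  finally show ?thesis .
qed

lemma char_poly_zero_mat: "char_poly (0\<^sub>m n n :: 'a :: comm_ring_1 mat) = [:0, 1:] ^ n"
proof -
  have "char_poly (0\<^sub>m n n :: 'a mat) = (\<Prod>a \<leftarrow> diag_mat (0\<^sub>m n n :: 'a mat). [:- a, 1:])"
    by (rule char_poly_upper_triangular[of _ n]) auto
  also have "diag_mat (0\<^sub>m n n :: 'a mat) = replicate n 0"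
    by (rule nth_equalityI) (auto simp: diag_mat_def)
  finally show ?thesis by simp
qed

text \<open>
  Sylvester's identity. Conjugation by the unipotent matrix \<open>P\<close> with upper right block \<open>B\<close> moves
  the product from one diagonal corner to the other: both
  \<open>L P\<close> and \<open>P R\<close> have the blocks \<open>B C, B C B, C, C B\<close>, so the block triangular matrices \<open>L\<close> and
  \<open>R\<close> are similar. Keeping the powers of the variable on both sides avoids a case distinction
  on which of the two dimensions is larger.
\<close>

lemma char_poly_mult_swap:
  fixes B C :: "'a :: idom mat"
  assumes B: "B \<in> carrier_mat n k" and C: "C \<in> carrier_mat k n"
  shows "char_poly (B * C) * [:0, 1:] ^ k = [:0, 1:] ^ n * char_poly (C * B)"
proof -
  let ?L = "four_block_mat (B * C) (0\<^sub>m n k) C (0\<^sub>m k k)"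
  let ?R = "four_block_mat (0\<^sub>m n n) (0\<^sub>m n k) C (C * B)"
  let ?P = "four_block_mat (1\<^sub>m n) B (0\<^sub>m k n) (1\<^sub>m k)"
  let ?Q = "four_block_mat (1\<^sub>m n) (- B) (0\<^sub>m k n) (1\<^sub>m k)"
  have BC: "B * C \<in> carrier_mat n n" and CB: "C * B \<in> carrier_mat k k"
    and mB: "- B \<in> carrier_mat n k" using B C by auto
  have L: "?L \<in> carrier_mat (n + k) (n + k)" and R: "?R \<in> carrier_mat (n + k) (n + k)"
    and P: "?P \<in> carrier_mat (n + k) (n + k)" and Q: "?Q \<in> carrier_mat (n + k) (n + k)"
    using B C by auto
  have PQ: "?P * ?Q = 1\<^sub>m (n + k)"
    by (subst mult_four_block_mat[of _ n n _ k _ k _ _ n _ k])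
      (use B mB in \<open>auto simp: uminus_l_inv_mat[OF B] simp flip: four_block_one_mat\<close>)
  have QP: "?Q * ?P = 1\<^sub>m (n + k)"
    by (subst mult_four_block_mat[of _ n n _ k _ k _ _ n _ k])
      (use B mB in \<open>auto simp: minus_r_inv_mat[OF B] simp flip: four_block_one_mat add_uminus_minus_mat[OF B B]\<close>)
  have "?L * ?P = four_block_mat (B * C) (B * C * B) C (C * B)"
    by (subst mult_four_block_mat[of _ n n _ k _ k _ _ n _ k]) (use B C BC CB in auto)
  moreover have "?P * ?R = four_block_mat (B * C) (B * (C * B)) C (C * B)"
    by (subst mult_four_block_mat[of _ n n _ k _ k _ _ n _ k]) (use B C BC CB in auto)
  ultimately have LP: "?L * ?P = ?P * ?R" using assoc_mult_mat[OF B C B] by simp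
  have "?L = ?L * (?P * ?Q)" unfolding PQ by (rule right_mult_one_mat[OF L, symmetric])
  also have "\<dots> = ?P * ?R * ?Q" using assoc_mult_mat[OF L P Q] LP by simp
  finally have eq: "?L = ?P * ?R * ?Q" .
  have "similar_mat ?L ?R"
    by (rule similar_matI[OF _ PQ QP eq]) (use L R P Q in blast)
  then have "char_poly ?L = char_poly ?R" by (rule char_poly_similar)
  then show ?thesis
    by (simp add: char_poly_four_block_upper_right_zero[OF BC C]
        char_poly_four_block_upper_right_zero[OF _ C CB] char_poly_zero_mat)
qed

text \<open>
  Invertibility of \<open>C B\<close> makes \<open>B\<close> injective, so the \<open>k\<close> columns of \<open>B\<close> are independent. It also
  makes the column spaces of \<open>B C\<close> and \<open>B\<close> equal: with \<open>W\<close> the inverse of \<open>C B\<close>, every \<open>B x\<close> is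
  the image of \<open>B W x\<close> under \<open>B C\<close>.
\<close>

lemma (in vec_space) rank_mult_if_det_swap_nonzero:
  assumes B: "B \<in> carrier_mat n k" and C: "C \<in> carrier_mat k n" and det: "det (C * B) \<noteq> 0"
  shows "rank (B * C) = k"
proof -
  have CB: "C * B \<in> carrier_mat k k" and BC: "B * C \<in> carrier_mat n n" using B C by auto
  from det_non_zero_imp_unit[OF CB det, of "()"]
  obtain W where W: "W \<in> carrier_mat k k" and inv: "C * B * W = 1\<^sub>m k"
    unfolding Units_def by (auto simp: ring_mat_def)
  have inj: "x = 0\<^sub>v k" if x: "x \<in> carrier_vec k" and "B *\<^sub>v x = 0\<^sub>v n" for x
  proof -
    have "C * B *\<^sub>v x = C *\<^sub>v (B *\<^sub>v x)" by (rule assoc_mult_mat_vec[OF C B x])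
    also have "\<dots> = 0\<^sub>v k" unfolding that using C by auto
    finally show ?thesis using det_0_iff_vec_prod_zero_field[OF CB] det x by auto
  qed
  have dist: "distinct (cols B)"
  proof (rule ccontr)
    assume "\<not> distinct (cols B)"
    then obtain i j where ij: "i \<noteq> j" "i < k" "j < k" and eq: "col B i = col B j"
      using B by (auto simp: distinct_conv_nth)
    have "col (C * B) i = col (C * B) j" using ij eq B C by simp
    then have "det (C * B) = 0" by (rule det_identical_cols[OF CB ij])
    with det show False by simp
  qed
  have "lin_indpt (set (cols B))"
    using lin_depE[OF B _ dist] inj by metis
  then have rank_B: "rank B = k" by (rule lin_indpt_full_rank[OF B dist])
  have "span (set (cols (B * C))) = span (set (cols B))"
    unfolding col_space_def[symmetric] col_space_eq[OF B] col_space_eq[OF BC]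
  proof (intro equalityI subsetI; clarsimp)
    fix x :: "'a vec" assume "x \<in> carrier_vec (dim_col C)"
    then have x: "x \<in> carrier_vec n" using C by simp
    show "\<exists>y\<in>carrier_vec (dim_col B). B *\<^sub>v y = B * C *\<^sub>v x"
      by (rule bexI[of _ "C *\<^sub>v x"]) (use B C x in auto)
  next
    fix x :: "'a vec" assume "x \<in> carrier_vec (dim_col B)"
    then have x: "x \<in> carrier_vec k" using B by simp
    have Wx: "W *\<^sub>v x \<in> carrier_vec k" and BWx: "B *\<^sub>v (W *\<^sub>v x) \<in> carrier_vec n"
      using W B x by auto
    have "B * C *\<^sub>v (B *\<^sub>v (W *\<^sub>v x)) = B *\<^sub>v (C * B * W *\<^sub>v x)"
      by (simp only: assoc_mult_mat_vec[OF B C BWx] assoc_mult_mat_vec[OF CB W x]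
        assoc_mult_mat_vec[OF C B Wx])
    then have "B * C *\<^sub>v (B *\<^sub>v (W *\<^sub>v x)) = B *\<^sub>v x" unfolding inv using x by simp
    then show "\<exists>y\<in>carrier_vec (dim_col C). B * C *\<^sub>v y = B *\<^sub>v x"
      using BWx C by auto
  qed
  with rank_B show ?thesis unfolding rank_def by simp
qed

section \<open>The vectors u and v\<close>

abbreviation ones_vec :: "nat \<Rightarrow> real vec" where
  "ones_vec n \<equiv> vec n (\<lambda>_. 1)"

lemma dim_u_v_vec: "dim_vec (u_vec m) = 4 * m" "dim_vec (v_vec m) = 4 * m"
  by (simp_all add: u_vec_def w_vec_def flip_vec_def v_vec_def)

lemma u_v_vec_carrier: "u_vec m \<in> carrier_vec (4 * m)" "v_vec m \<in> carrier_vec (4 * m)"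
  by (intro carrier_vecI dim_u_v_vec)+

lemma v_entry_cases: "v_entry i = (if i mod 4 = 0 \<or> i mod 4 = 1 then 1 else -1)" if "i \<ge> 1"
proof -
  obtain k where k: "i = Suc k" using \<open>i \<ge> 1\<close> by (cases i) auto
  have "k mod 4 < 4" by simp
  then have "k mod 4 = 0 \<or> k mod 4 = 1 \<or> k mod 4 = 2 \<or> k mod 4 = 3" by linarith
  then show ?thesis unfolding k v_entry_def by (elim disjE) (simp_all add: mod_Suc)
qed

lemma v_entry_sq: "i \<ge> 1 \<Longrightarrow> v_entry i * v_entry i = 1"
  by (simp add: v_entry_cases)

text \<open>
  This turns the case distinction of the criss-cross rule into multiplication and is
  the reason for the low rank.
\<close>

lemma v_entry_mult:
  assumes "i \<ge> 1" "j \<ge> 1"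
  shows "v_entry i * v_entry j = (if criss_cross i = criss_cross j then 1 else -1)"
proof -
  have "criss_cross i = (if i mod 4 = 0 \<or> i mod 4 = 1 then 0 else 1)" for i
    unfolding criss_cross_def by presburger
  then show ?thesis using assms by (simp add: v_entry_cases)
qed

text \<open>The symmetry of the sign pattern that makes the two halves of \<open>u\<close> fit together.\<close>

lemma v_entry_flip:
  assumes "1 \<le> i" "1 \<le> j" and sum: "i + j = 4 * m + 1"
  shows "v_entry j = v_entry i"
proof -
  have "(i mod 4 + j mod 4) mod 4 = 1" unfolding mod_add_eq sum by simp
  moreover have "k mod 4 = 0 \<or> k mod 4 = 1 \<or> k mod 4 = 2 \<or> k mod 4 = 3" for k :: nat
    using mod_less_divisor[of 4 k] by linarith
  from this[of i] this[of j] have "?thesis \<or> (i mod 4 + j mod 4) mod 4 \<noteq> 1"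
    by (elim disjE) (simp_all add: v_entry_cases[OF assms(1)] v_entry_cases[OF assms(2)])
  ultimately show ?thesis by blast
qed

lemma v_vec_index: "i < 4 * m \<Longrightarrow> v_vec m $ i = v_entry (i + 1)"
  by (simp add: v_vec_def)

text \<open>
  The formula that defines \<open>w\<close> continues to the second half of \<open>u\<close>: reflecting an index about the
  centre keeps the sign \<open>v\<^sub>i\<close> and negates \<open>n + 1 - 2 i\<close>, which is why the second half is
  \<open>- flip(w)\<close>.
\<close>

lemma u_vec_index:
  assumes i: "i < 4 * m"
  shows "u_vec m $ i = v_entry (i + 1) * (real (4 * m) + 1 - 2 * real (i + 1))"
proof (cases "i < 2 * m")
  case True
  then show ?thesis by (simp add: u_vec_def w_vec_def flip_vec_def)
next
  case False
  define k where "k = 4 * m - 1 - i"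
  have k: "k < 2 * m" "k = 2 * m - 1 - (i - 2 * m)" "k + 1 = 4 * m + 1 - (i + 1)"
    "real k = real (4 * m) - 1 - real i"
    using i False by (auto simp: k_def)
  have dim_w: "dim_vec (w_vec m) = 2 * m" by (simp add: w_vec_def)
  have "u_vec m $ i = - (flip_vec (w_vec m) $ (i - 2 * m))"
    using i False by (simp add: u_vec_def dim_w flip_vec_def)
  also have "flip_vec (w_vec m) $ (i - 2 * m) = w_vec m $ (2 * m - 1 - (i - 2 * m))"
    using i False unfolding flip_vec_def dim_w by (intro index_vec) simp
  also have "w_vec m $ (2 * m - 1 - (i - 2 * m)) = w_vec m $ k" by (simp only: k(2))
  also have "w_vec m $ k = v_entry (k + 1) * (real (4 * m) + 1 - 2 * real (k + 1))"
    using k(1) by (simp add: w_vec_def)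
  also have "v_entry (k + 1) = v_entry (i + 1)"
    by (rule v_entry_flip[of _ _ m]) (use i k(3) in auto)
  finally show ?thesis using k(4) by (simp add: algebra_simps)
qed

section \<open>Inner products\<close>

text \<open>
  In each block of four the pattern \<open>1, - 1, - 1, 1\<close> takes a difference of two first differences, so it
  annihilates affine sequences. The constant sequence gives the orthogonality of \<open>v\<close> and \<open>e\<close>,
  the sequence \<open>n + 1 - 2 i\<close> that of \<open>u\<close> and \<open>e\<close>.
\<close>

lemma sum_v_entry_times_affine:
  "(\<Sum>i<4 * m. v_entry (i + 1) * (c + d * real (i + 1))) = 0"
proof (induction m)
  case (Suc m)
  have "(4 * m + 1) mod 4 = 1" "(4 * m + 2) mod 4 = 2"
    "(4 * m + 3) mod 4 = 3" "(4 * m + 4) mod 4 = 0"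
    by presburger+
  then have v: "v_entry (4 * m + 1) = 1" "v_entry (4 * m + 2) = -1"
    "v_entry (4 * m + 3) = -1" "v_entry (4 * m + 4) = 1"
    by (simp_all add: v_entry_cases)
  have "4 * Suc m = Suc (Suc (Suc (Suc (4 * m))))" by simp
  then have "(\<Sum>i<4 * Suc m. f (i + 1)) = (\<Sum>i<4 * m. f (i + 1))
      + f (4 * m + 1) + f (4 * m + 2) + f (4 * m + 3) + f (4 * m + 4)" for f :: "nat \<Rightarrow> real"
    by (simp only: sum.lessThan_Suc) (simp add: eval_nat_numeral)
  from this[of "\<lambda>i. v_entry i * (c + d * real i)"] show ?case
    unfolding Suc v by (simp add: algebra_simps)
qed simp

lemma sum_centred: "(\<Sum>i<n. real n + 1 - 2 * real (i + 1)) = 0"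
proof -
  \<comment> \<open>The summand depends on the upper limit, so the induction needs a separate constant \<open>c\<close>.\<close>
  have "(\<Sum>i<N. c - 2 * real (i + 1)) = real N * (c - real N - 1)" for N c
    by (induction N) (simp_all add: algebra_simps)
  from this[where N = n and c = "real n + 1"] show ?thesis by simp
qed

lemma sum_centred_squares:
  "(\<Sum>i<n. (real n + 1 - 2 * real (i + 1))\<^sup>2) = real n * ((real n)\<^sup>2 - 1) / 3"
proof -
  have "3 * (\<Sum>i<N. (c - 2 * real (i + 1))\<^sup>2)
      = real N * (3 * c\<^sup>2 - 6 * c * (real N + 1) + 2 * (real N + 1) * (2 * real N + 1))" for N c
    by (induction N) (simp_all add: algebra_simps power2_eq_square)
  from this[where N = n and c = "real n + 1"] show ?thesis
    by (simp add: algebra_simps power2_eq_square)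
qed

lemma scalar_prod_ones: "ones_vec n \<bullet> ones_vec n = real n"
  by (simp add: scalar_prod_def)

lemma scalar_prod_ones_v: "ones_vec (4 * m) \<bullet> v_vec m = 0"
  using sum_v_entry_times_affine[where c = 1 and d = 0]
  by (simp add: scalar_prod_def dim_u_v_vec v_vec_index atLeast0LessThan)

lemma scalar_prod_ones_u: "ones_vec (4 * m) \<bullet> u_vec m = 0"
  using sum_v_entry_times_affine[where c = "real (4 * m) + 1" and d = "-2"]
  by (simp add: scalar_prod_def dim_u_v_vec u_vec_index atLeast0LessThan)

lemma scalar_prod_v_v: "v_vec m \<bullet> v_vec m = real (4 * m)"
  by (simp add: scalar_prod_def dim_u_v_vec v_vec_index v_entry_sq)

lemma scalar_prod_v_u: "v_vec m \<bullet> u_vec m = 0"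
proof -
  have "v_vec m \<bullet> u_vec m = (\<Sum>i<4 * m. real (4 * m) + 1 - 2 * real (i + 1))"
    unfolding scalar_prod_def dim_u_v_vec atLeast0LessThan
  proof (rule sum.cong[OF refl])
    fix i assume "i \<in> {..<4 * m}"
    then have "v_vec m $ i * u_vec m $ i
        = (v_entry (i + 1) * v_entry (i + 1)) * (real (4 * m) + 1 - 2 * real (i + 1))"
      by (simp add: v_vec_index u_vec_index)
    then show "v_vec m $ i * u_vec m $ i = real (4 * m) + 1 - 2 * real (i + 1)"
      by (simp add: v_entry_sq)
  qed
  then show ?thesis by (simp only: sum_centred)
qed

lemma scalar_prod_u_u:
  "u_vec m \<bullet> u_vec m = real (4 * m) * ((real (4 * m))\<^sup>2 - 1) / 3"
proof -
  have "u_vec m \<bullet> u_vec m = (\<Sum>i<4 * m. (real (4 * m) + 1 - 2 * real (i + 1))\<^sup>2)"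
    unfolding scalar_prod_def dim_u_v_vec atLeast0LessThan
  proof (rule sum.cong[OF refl])
    fix i assume "i \<in> {..<4 * m}"
    then have "u_vec m $ i * u_vec m $ i
        = (v_entry (i + 1) * v_entry (i + 1)) * (real (4 * m) + 1 - 2 * real (i + 1))\<^sup>2"
      by (simp add: u_vec_index power2_eq_square)
    then show "u_vec m $ i * u_vec m $ i = (real (4 * m) + 1 - 2 * real (i + 1))\<^sup>2"
      by (simp add: v_entry_sq)
  qed
  then show ?thesis by (simp only: sum_centred_squares)
qed

lemmas scalar_prods =
  scalar_prod_ones scalar_prod_ones_v scalar_prod_ones_u
  scalar_prod_v_v scalar_prod_v_u scalar_prod_u_u
  trans[OF comm_scalar_prod[OF u_v_vec_carrier(1) vec_carrier] scalar_prod_ones_u]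
  trans[OF comm_scalar_prod[OF u_v_vec_carrier(2) vec_carrier] scalar_prod_ones_v]
  trans[OF comm_scalar_prod[OF u_v_vec_carrier(1) u_v_vec_carrier(2)] scalar_prod_v_u]

section \<open>The factorization of the magic square\<close>

text \<open>
  The two factors list the outer products in the decomposition of \<open>M\<close>. Since \<open>u\<close> is multiplied by
  \<open>v\<^sup>T\<close> and conversely, the rows of the right factor follow the order \<open>e, v, u\<close>; the scalar
  coefficients are put there.
\<close>

definition magic_left :: "nat \<Rightarrow> real mat" where
  "magic_left m = mat_of_cols (4 * m) [ones_vec (4 * m), u_vec m, v_vec m]"

definition magic_right :: "nat \<Rightarrow> real mat" where
  "magic_right m = mat_of_rows (4 * m)
     [(((real (4 * m))\<^sup>2 + 1) / 2) \<cdot>\<^sub>v ones_vec (4 * m),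
      (real (4 * m) / 2) \<cdot>\<^sub>v v_vec m, (1 / 2) \<cdot>\<^sub>v u_vec m]"

lemma magic_left_carrier: "magic_left m \<in> carrier_mat (4 * m) 3"
  and magic_right_carrier: "magic_right m \<in> carrier_mat 3 (4 * m)"
  by (auto simp: magic_left_def magic_right_def)

lemma magic_mat_index:
  assumes "i < 4 * m" "j < 4 * m"
  shows "magic_mat (4 * m) $$ (i, j) = ((real (4 * m))\<^sup>2 + 1) / 2
    + real (4 * m) / 2 * (u_vec m $ i * v_vec m $ j) + 1 / 2 * (v_vec m $ i * u_vec m $ j)"
proof -
  have uv: "u_vec m $ i * v_vec m $ j
      = v_entry (i + 1) * v_entry (j + 1) * (real (4 * m) + 1 - 2 * real (i + 1))"
    and vu: "v_vec m $ i * u_vec m $ j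
      = v_entry (i + 1) * v_entry (j + 1) * (real (4 * m) + 1 - 2 * real (j + 1))"
    using assms by (simp_all add: u_vec_index v_vec_index)
  have M: "magic_mat (4 * m) $$ (i, j) = magic_entry (4 * m) (i + 1) (j + 1)"
    using assms by (simp add: magic_mat_def)
  have cc: "v_entry (i + 1) * v_entry (j + 1)
      = (if criss_cross (i + 1) = criss_cross (j + 1) then 1 else -1)"
    by (rule v_entry_mult) auto
  show ?thesis
    unfolding M uv vu cc magic_entry_def square_S_def
    by (simp add: algebra_simps power2_eq_square add_divide_distrib diff_divide_distrib)
qed

lemma magic_mat_factorization: "magic_mat (4 * m) = magic_left m * magic_right m"
proof (rule eq_matI)
  fix i j assume "i < dim_row (magic_left m * magic_right m)"
    "j < dim_col (magic_left m * magic_right m)"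
  then have ij: "i < 4 * m" "j < 4 * m" using magic_left_carrier[of m] magic_right_carrier[of m] by auto
  have "(magic_left m * magic_right m) $$ (i, j)
      = (\<Sum>l<3. magic_left m $$ (i, l) * magic_right m $$ (l, j))"
    using ij magic_left_carrier[of m] magic_right_carrier[of m]
    by (auto simp: scalar_prod_def atLeast0LessThan intro!: sum.cong)
  also have "\<dots> = magic_mat (4 * m) $$ (i, j)"
    unfolding magic_mat_index[OF ij] using ij
    by (simp add: numeral_3_eq_3 magic_left_def magic_right_def mat_of_cols_index
        mat_of_rows_index dim_u_v_vec algebra_simps)
  finally show "magic_mat (4 * m) $$ (i, j) = (magic_left m * magic_right m) $$ (i, j)" ..
qed (use magic_left_carrier[of m] magic_right_carrier[of m] in \<open>auto simp: magic_mat_def\<close>)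

section \<open>The three by three product\<close>

text \<open>
  The parameter stands for the order of the magic square. It is real because only the algebraic
  form of the entries matters here.
\<close>

definition magic_core :: "real \<Rightarrow> real mat" where
  "magic_core r = four_block_mat (mat 1 1 (\<lambda>_. r * (r\<^sup>2 + 1) / 2)) (0\<^sub>m 1 2) (0\<^sub>m 2 1)
     (mat 2 2 (\<lambda>(i, j). if i = j then 0 else if i = 0 then r\<^sup>2 / 2 else r * (r\<^sup>2 - 1) / 6))"

lemma magic_right_mult_left: "magic_right m * magic_left m = magic_core (real (4 * m))"
proof (rule eq_matI)
  fix i j assume "i < dim_row (magic_core (real (4 * m)))" "j < dim_col (magic_core (real (4 * m)))"
  then have ij: "i < 3" "j < 3" by (auto simp: magic_core_def)
  then have "i = 0 \<or> i = 1 \<or> i = 2" "j = 0 \<or> j = 1 \<or> j = 2" by auto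
  then show "(magic_right m * magic_left m) $$ (i, j) = magic_core (real (4 * m)) $$ (i, j)"
    unfolding magic_right_def magic_left_def magic_core_def
    by (elim disjE) (simp_all add: u_v_vec_carrier dim_u_v_vec scalar_prods power2_eq_square)
qed (auto simp: magic_core_def magic_left_def magic_right_def)

lemma det_2_by_2:
  fixes A :: "'a :: comm_ring_1 mat"
  assumes A: "A \<in> carrier_mat 2 2"
  shows "det A = A $$ (0, 0) * A $$ (1, 1) - A $$ (0, 1) * A $$ (1, 0)"
proof -
  have "mat_delete A i j \<in> carrier_mat 1 1" for i j
    using mat_delete_carrier[OF A] by simp
  then show ?thesis
    by (subst laplace_expansion_column[OF A, of 0])
      (simp_all add: cofactor_def det_single numeral_2_eq_2 mat_delete_def A[THEN carrier_matD(1)]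
        A[THEN carrier_matD(2)])
qed

lemma det_magic_core:
  "det (magic_core r) = - (r * (r\<^sup>2 + 1) / 2 * (r\<^sup>2 / 2) * (r * (r\<^sup>2 - 1) / 6))"
  unfolding magic_core_def
  by (subst det_four_block_mat_upper_right_zero[OF _ refl, of _ 1])
    (simp_all add: det_single det_2_by_2)

lemma char_poly_magic_core:
  assumes lam: "lam\<^sup>2 = r\<^sup>2 / 2 * (r * (r\<^sup>2 - 1) / 6)"
  shows "char_poly (magic_core r) = [:- (r * (r\<^sup>2 + 1) / 2), 1:] * ([:- lam, 1:] * [:lam, 1:])"
proof -
  let ?D = "mat 2 2 (\<lambda>(i, j). if i = j then 0 else if i = 0 then r\<^sup>2 / 2 else r * (r\<^sup>2 - 1) / 6)"
  have "char_poly ?D = det (char_poly_matrix ?D)" by (simp add: char_poly_def)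
  also have "\<dots> = [:- lam, 1:] * [:lam, 1:]"
    by (subst det_2_by_2) (use lam in \<open>simp_all add: char_poly_matrix_def power2_eq_square\<close>)
  finally have D: "char_poly ?D = [:- lam, 1:] * [:lam, 1:]" .
  have "char_poly (mat 1 1 (\<lambda>_. c)) = [:- c, 1:]" for c :: real
    by (simp add: char_poly_defs det_single)
  with D show ?thesis
    unfolding magic_core_def
    by (subst char_poly_four_block_upper_right_zero[of _ 1 _ 2]) simp_all
qed

section \<open>Rank, spectrum and eigenvectors\<close>

lemma rank_magic_mat:
  assumes "m \<ge> 1"
  shows "vec_space.rank (4 * m) (magic_mat (4 * m)) = 3"
proof -
  have "1 < real (4 * m)" using assms by simp
  then have "1 < (real (4 * m))\<^sup>2" by (rule one_less_power) simp
  then have "det (magic_core (real (4 * m))) \<noteq> 0"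
    using assms unfolding det_magic_core by (auto simp: add_nonneg_eq_0_iff)
  then show ?thesis
    unfolding magic_mat_factorization
    by (intro vec_space.rank_mult_if_det_swap_nonzero magic_left_carrier magic_right_carrier)
      (simp add: magic_right_mult_left)
qed

text \<open>
  The spectrum is compared only away from zero, where the powers of the variable in Sylvester's
  identity contribute nothing; no division by them is necessary.
\<close>

lemma nonzero_nontrivial_eigenvalues:
  assumes m: "m \<ge> 1" and lam0: "lam \<noteq> 0"
    and lam: "lam\<^sup>2 = (real (4 * m))\<^sup>2 / 2 * (real (4 * m) * ((real (4 * m))\<^sup>2 - 1) / 6)"
  shows "filter_mset (\<lambda>z. z \<noteq> 0) (nontrivial_eigenvalues (4 * m))
    = {#complex_of_real lam, complex_of_real (- lam)#}"
proof -
  let ?n = "4 * m" let ?M = "magic_mat ?n" let ?X = "[:0, 1:] :: complex poly"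
  let ?c = complex_of_real
  let ?p = "char_poly (map_mat ?c ?M)"
  interpret h: map_poly_inj_idom_hom ?c ..
  have M: "?M \<in> carrier_mat ?n ?n" by (simp add: magic_mat_def)
  have mu0: "magic_sum ?n \<noteq> 0" using m by (simp add: magic_sum_def add_nonneg_eq_0_iff)
  have "char_poly ?M * [:0, 1:] ^ 3
      = [:0, 1:] ^ ?n * ([:- magic_sum ?n, 1:] * ([:- lam, 1:] * [:lam, 1:]))"
    using char_poly_mult_swap[OF magic_left_carrier[of m] magic_right_carrier[of m]]
    unfolding magic_mat_factorization[symmetric] magic_right_mult_left char_poly_magic_core[OF lam]
      magic_sum_def .
  from arg_cong[OF this, of "map_poly ?c"]
  have eq: "?p * ?X ^ 3
      = ?X ^ ?n * ([:- ?c (magic_sum ?n), 1:] * ([:- ?c lam, 1:] * [:?c lam, 1:]))"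
    unfolding h.hom_mult h.hom_power of_real_hom.char_poly_hom[OF M] by simp
  have p: "?p \<noteq> 0" using degree_monic_char_poly[of "map_mat ?c ?M" ?n] M by auto
  have no_zero: "filter_mset (\<lambda>z. z \<noteq> 0) (proots (?X ^ k)) = {#}" for k
    by (induction k) (auto simp: proots_power)
  have "filter_mset (\<lambda>z. z \<noteq> 0) (proots (?p * ?X ^ 3)) = filter_mset (\<lambda>z. z \<noteq> 0) (proots ?p)"
    by (subst proots_mult) (use p no_zero in simp_all)
  moreover have "filter_mset (\<lambda>z. z \<noteq> 0) (proots (?p * ?X ^ 3))
      = {#?c (magic_sum ?n), ?c lam, ?c (- lam)#}"
  proof -
    have "proots ([:- x, 1:] * ([:- y, 1:] * [:y, 1:])) = {#x, y, - y#}" for x y :: complex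
      by (simp add: proots_mult del: mult_pCons_left mult_pCons_right)
    then have "proots (?X ^ ?n * ([:- ?c (magic_sum ?n), 1:] * ([:- ?c lam, 1:] * [:?c lam, 1:])))
        = proots (?X ^ ?n) + {#?c (magic_sum ?n), ?c lam, ?c (- lam)#}"
      by (subst proots_mult) (simp_all del: mult_pCons_left mult_pCons_right)
    then show ?thesis unfolding eq using no_zero mu0 lam0 by simp
  qed
  ultimately have "filter_mset (\<lambda>z. z \<noteq> 0) (eigenvalue_mset ?M)
      = {#?c (magic_sum ?n), ?c lam, ?c (- lam)#}"
    by (simp add: eigenvalue_mset_def)
  then show ?thesis using mu0 by (simp add: nontrivial_eigenvalues_def)
qed

text \<open>
  On the span of \<open>u\<close> and \<open>v\<close> the all-ones term vanishes and \<open>M\<close> exchanges the two directions; the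
  two equations for \<open>a\<close>, \<open>b\<close> and \<open>l\<close> compare the coefficients of \<open>u\<close> and \<open>v\<close> in \<open>M x = l x\<close>.
\<close>

lemma magic_mat_mult_comb:
  assumes x: "x = a \<cdot>\<^sub>v v_vec m + b \<cdot>\<^sub>v u_vec m"
    and 1: "a * ((real (4 * m))\<^sup>2 / 2) = l * b"
    and 2: "b * (real (4 * m) * ((real (4 * m))\<^sup>2 - 1) / 6) = l * a"
  shows "magic_mat (4 * m) *\<^sub>v x = l \<cdot>\<^sub>v x"
proof (rule eq_vecI)
  let ?r = "real (4 * m)"
  note c = u_v_vec_carrier[of m]
  have xc: "x \<in> carrier_vec (4 * m)" unfolding x using c by simp
  have prods: "ones_vec (4 * m) \<bullet> x = 0" "v_vec m \<bullet> x = a * ?r"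
    "u_vec m \<bullet> x = b * (?r * (?r\<^sup>2 - 1) / 3)"
    unfolding x using c by (simp_all add: scalar_prod_add_distrib[of _ "4 * m"] scalar_prods)
  fix i assume "i < dim_vec (l \<cdot>\<^sub>v x)"
  then have i: "i < 4 * m" using xc by simp
  have "(magic_mat (4 * m) *\<^sub>v x) $ i = (\<Sum>j<4 * m. magic_mat (4 * m) $$ (i, j) * x $ j)"
    using i xc by (simp add: magic_mat_def scalar_prod_def atLeast0LessThan)
  also have "\<dots> = (\<Sum>j<4 * m. (?r\<^sup>2 + 1) / 2 * (ones_vec (4 * m) $ j * x $ j)
      + ?r / 2 * u_vec m $ i * (v_vec m $ j * x $ j) + 1 / 2 * v_vec m $ i * (u_vec m $ j * x $ j))"
    by (rule sum.cong[OF refl], subst magic_mat_index)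
      (use i in \<open>simp_all add: algebra_simps\<close>)
  also have "\<dots> = (?r\<^sup>2 + 1) / 2 * (ones_vec (4 * m) \<bullet> x)
      + ?r / 2 * u_vec m $ i * (v_vec m \<bullet> x) + 1 / 2 * v_vec m $ i * (u_vec m \<bullet> x)"
    using xc by (simp add: scalar_prod_def atLeast0LessThan sum.distrib sum_distrib_left)
  also have "\<dots> = a * (?r\<^sup>2 / 2) * u_vec m $ i + b * (?r * (?r\<^sup>2 - 1) / 6) * v_vec m $ i"
    unfolding prods by (simp add: power2_eq_square)
  also have "\<dots> = (l \<cdot>\<^sub>v x) $ i"
    unfolding 1 2 x using i c by (simp add: algebra_simps)
  finally show "(magic_mat (4 * m) *\<^sub>v x) $ i = (l \<cdot>\<^sub>v x) $ i" .
qed (simp add: x magic_mat_def dim_u_v_vec)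

lemma magic_mat_eigenvector:
  assumes m: "m \<ge> 1" and a: "a \<noteq> 0" and x: "x = a \<cdot>\<^sub>v v_vec m + b \<cdot>\<^sub>v u_vec m"
    and 1: "a * ((real (4 * m))\<^sup>2 / 2) = l * b"
    and 2: "b * (real (4 * m) * ((real (4 * m))\<^sup>2 - 1) / 6) = l * a"
  shows "eigenvector (magic_mat (4 * m)) x l"
proof -
  have "v_vec m \<bullet> x = a * real (4 * m)"
    unfolding x using u_v_vec_carrier[of m]
    by (simp add: scalar_prod_add_distrib[of _ "4 * m"] scalar_prods)
  with m a have "x \<noteq> 0\<^sub>v (4 * m)" using u_v_vec_carrier[of m] by auto
  moreover have "x \<in> carrier_vec (4 * m)" unfolding x using u_v_vec_carrier[of m] by simp
  ultimately show ?thesis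
    unfolding eigenvector_def using magic_mat_mult_comb[OF x 1 2] by (simp add: magic_mat_def)
qed

theorem theorem5p1:
  fixes m n :: nat and lam :: real
  assumes "m \<ge> 1"
    and "n = 4 * m"
    and "lam = real n / 2 * sqrt ((real n ^ 3 - real n) / 3)"
  shows "vec_space.rank n (magic_mat n) = 3
    \<and> filter_mset (\<lambda>z. z \<noteq> 0) (nontrivial_eigenvalues n)
        = {#complex_of_real lam, complex_of_real (- lam)#}
    \<and> eigenvector (magic_mat n)
        (sqrt ((real n)\<^sup>2 - 1) \<cdot>\<^sub>v v_vec m + sqrt (3 * real n) \<cdot>\<^sub>v u_vec m) lam
    \<and> eigenvector (magic_mat n)
        (sqrt ((real n)\<^sup>2 - 1) \<cdot>\<^sub>v v_vec m - sqrt (3 * real n) \<cdot>\<^sub>v u_vec m) (- lam)"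
proof -
  define r a b where "r = real (4 * m)" and "a = sqrt (r\<^sup>2 - 1)" and "b = sqrt (3 * r)"
  have r: "r \<ge> 4" using assms(1) by (simp add: r_def)
  then have "r\<^sup>2 \<ge> 4\<^sup>2" by (intro power_mono) auto
  then have a2: "a * a = r\<^sup>2 - 1" and a0: "a > 0" by (auto simp: a_def)
  have b2: "b * b = 3 * r" and b0: "b > 0" using r by (auto simp: b_def)
  have "(r ^ 3 - r) / 3 = (r\<^sup>2 - 1) * (3 * r) / 9"
    by (simp add: field_simps power2_eq_square power3_eq_cube)
  moreover have "sqrt 9 = (3 :: real)" by (rule real_sqrt_unique) auto
  ultimately have "sqrt ((r ^ 3 - r) / 3) = a * b / 3"
    by (simp only: a_def b_def real_sqrt_mult real_sqrt_divide)
  then have lam: "lam = r * a * b / 6" using assms(2,3) by (simp add: r_def)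
  \<comment> \<open>The choice of \<open>a\<close> and \<open>b\<close> balances the two coefficients: \<open>lam = r a b / 6\<close>, so each equation
    reduces to the square of one of them.\<close>
  have 1: "a * (r\<^sup>2 / 2) = lam * b"
  proof -
    have "lam * b = r * a * (b * b) / 6" by (simp add: lam)
    then show ?thesis by (simp add: b2 power2_eq_square)
  qed
  have 2: "b * (r * (r\<^sup>2 - 1) / 6) = lam * a"
  proof -
    have "lam * a = r * b * (a * a) / 6" by (simp add: lam)
    then show ?thesis by (simp add: a2)
  qed
  have lam0: "lam \<noteq> 0" using a0 b0 r by (simp add: lam)
  have "lam\<^sup>2 = r * r * (a * a) * (b * b) / 36" by (simp add: lam power2_eq_square)
  then have lam2: "lam\<^sup>2 = r\<^sup>2 / 2 * (r * (r\<^sup>2 - 1) / 6)"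
    by (simp add: a2 b2 power2_eq_square)
  have minus: "a \<cdot>\<^sub>v v_vec m - b \<cdot>\<^sub>v u_vec m = a \<cdot>\<^sub>v v_vec m + (- b) \<cdot>\<^sub>v u_vec m"
    by (rule eq_vecI) (auto simp: dim_u_v_vec)
  have "eigenvector (magic_mat (4 * m)) (a \<cdot>\<^sub>v v_vec m + b \<cdot>\<^sub>v u_vec m) lam"
    by (rule magic_mat_eigenvector[OF assms(1) _ refl])
      (use a0 1 2 in \<open>auto simp: r_def\<close>)
  moreover have "eigenvector (magic_mat (4 * m)) (a \<cdot>\<^sub>v v_vec m - b \<cdot>\<^sub>v u_vec m) (- lam)"
    by (rule magic_mat_eigenvector[OF assms(1) _ minus])
      (use a0 1 2 in \<open>auto simp: r_def\<close>)
  ultimately show ?thesis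
    using rank_magic_mat[OF assms(1)]
      nonzero_nontrivial_eigenvalues[OF assms(1) lam0 lam2[unfolded r_def]]
    unfolding assms(2) a_def b_def r_def by simp
qed

end
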